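(* Let $T$ be a tableau of shape $\beta/\alpha$ with entries from $[k]$. Then its stable complement $T^S$ is a stable tableau with stable shape $(\infty^k,\alpha)/\beta$ and entries from $[k]$. Similarly, if $T$ is a stable tableau with entries from $[k]$, then $T^S$ is (after removing the common initial parts equal to $\infty$) an ordinary tableau with entries from $[k]$. In either case $T^{SS}=T$, identifying tableaux that differ only by a vertical shift.
   Context: A shape is a finite weakly decreasing sequence of integers; a stable shape is a finite weakly decreasing sequence of integers and the symbols $\infty$ and $\bar\infty$, where $\bar\infty<n<\infty$ for every integer $n$; stable shapes are regarded as having arbitrarily many trailing $\bar\infty$'s and are ordered componentwise. $(\infty^i,\gamma)$ denotes $\gamma$ with $i$ initial parts $\infty$ prepended. An ordinary horizontal strip $\beta/\alpha$ satisfies $\beta_i\geq\alpha_i\geq\beta_{i+1}$ for all $i$; a tableau with entries from $[k]$ is a chain $\beta^0\subseteq\cdots\subseteq\beta^k$ of shapes with horizontal-strip differences. A stable horizontal strip is a pair of stable shapes $\alpha\subseteq\beta$ such that, if $\alpha_m$ is the first finite part of $\alpha$ and $\beta_n$ the last finite part of $\beta$, then $\alpha_{m-1}=\infty=\beta_m>\alpha_m\geq\beta_{m+1}\geq\alpha_{m+1}\geq\cdots\geq\alpha_{n-1}\geq\beta_n>\alpha_n=\bar\infty=\beta_{n+1}$. A stable tableau with entries from $[k]$ is a chain $\beta^0\subseteq\cdots\subseteq\beta^k$ of stable shapes with each $\beta^i/\beta^{i-1}$ a stable horizontal strip. The stable complement of a (stable or ordinary) tableau $T:\beta^0\subseteq\cdots\subseteq\beta^k$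 is the chain $T^S:\beta^k\subseteq(\infty,\beta^{k-1})\subseteq(\infty^2,\beta^{k-2})\subseteq\cdots\subseteq(\infty^k,\beta^0)$. Tableaux differing only by a vertical shift (e.g. removing or prepending the same number of $\infty$ parts in each shape) are identified. *)

theory Defs
  imports Main "HOL-Library.Extended"
begin

text \<open>Parts are indexed from 0 throughout, so the part written \<open>\<gamma>\<^sub>i\<close> on paper is \<open>\<gamma> (i - 1)\<close> here.\<close>

definition shape :: "int list \<Rightarrow> bool" where
  "shape \<gamma> \<longleftrightarrow> sorted_wrt (\<ge>) \<gamma>"

text \<open>A stable shape is the full sequence of its parts, including the infinitely many trailing
  parts \<open>-\<infinity>\<close>; two finite sequences differing only in trailing \<open>-\<infinity>\<close>'s thus give the same
  stable shape. The componentwise order is the pointwise order on functions.\<close>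

definition stable_shape :: "(nat \<Rightarrow> int extended) \<Rightarrow> bool" where
  "stable_shape \<gamma> \<longleftrightarrow> antimono \<gamma> \<and> (\<exists>l. \<forall>i\<ge>l. \<gamma> i = Minf)"

definition stable_of :: "int list \<Rightarrow> nat \<Rightarrow> int extended" where
  "stable_of \<gamma> = (\<lambda>i. if i < length \<gamma> then Fin (\<gamma> ! i) else Minf)"

definition prepend_inf :: "nat \<Rightarrow> (nat \<Rightarrow> int extended) \<Rightarrow> nat \<Rightarrow> int extended" where
  "prepend_inf m \<gamma> = (\<lambda>i. if i < m then Pinf else \<gamma> (i - m))"

text \<open>Ordinary shapes are not padded: the shapes of an ordinary strip have equally many parts,
  and the inequalities are imposed wherever the parts in question exist.\<close>

definition horizontal_strip :: "int list \<Rightarrow> int list \<Rightarrow> bool" where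
  "horizontal_strip \<alpha> \<beta> \<longleftrightarrow> length \<alpha> = length \<beta> \<and>
     (\<forall>i < length \<beta>. \<beta> ! i \<ge> \<alpha> ! i) \<and>
     (\<forall>i. Suc i < length \<beta> \<longrightarrow> \<alpha> ! i \<ge> \<beta> ! Suc i)"

definition tableau :: "nat \<Rightarrow> int list list \<Rightarrow> bool" where
  "tableau k T \<longleftrightarrow> length T = Suc k \<and> (\<forall>\<gamma> \<in> set T. shape \<gamma>) \<and>
     (\<forall>i<k. horizontal_strip (T ! i) (T ! Suc i))"

definition tableau_of_shape :: "nat \<Rightarrow> int list list \<Rightarrow> int list \<Rightarrow> int list \<Rightarrow> bool" where
  "tableau_of_shape k T \<beta> \<alpha> \<longleftrightarrow> tableau k T \<and> T ! k = \<beta> \<and> T ! 0 = \<alpha>"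

definition finite_part :: "(nat \<Rightarrow> int extended) \<Rightarrow> nat \<Rightarrow> bool" where
  "finite_part \<gamma> i \<longleftrightarrow> (\<exists>z. \<gamma> i = Fin z)"

definition first_finite :: "(nat \<Rightarrow> int extended) \<Rightarrow> nat \<Rightarrow> bool" where
  "first_finite \<gamma> m \<longleftrightarrow> finite_part \<gamma> m \<and> (\<forall>i<m. \<not> finite_part \<gamma> i)"

definition last_finite :: "(nat \<Rightarrow> int extended) \<Rightarrow> nat \<Rightarrow> bool" where
  "last_finite \<gamma> n \<longleftrightarrow> finite_part \<gamma> n \<and> (\<forall>i>n. \<not> finite_part \<gamma> i)"

text \<open>The chain
  \<open>\<alpha>\<^bsub>m-1\<^esub> = \<infinity> = \<beta>\<^bsub>m\<^esub> > \<alpha>\<^bsub>m\<^esub> \<ge> \<beta>\<^bsub>m+1\<^esub> \<ge> \<alpha>\<^bsub>m+1\<^esub> \<ge> \<dots> \<ge> \<alpha>\<^bsub>n-1\<^esub> \<ge> \<beta>\<^bsub>n\<^esub> > \<alpha>\<^bsub>n\<^esub> = -\<infinity> = \<beta>\<^bsub>n+1\<^esub>\<close>,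
  where the condition on \<open>\<alpha>\<^bsub>m-1\<^esub>\<close> is void if there is no such part.\<close>

definition interlacing ::
  "nat \<Rightarrow> nat \<Rightarrow> (nat \<Rightarrow> int extended) \<Rightarrow> (nat \<Rightarrow> int extended) \<Rightarrow> bool" where
  "interlacing m n \<alpha> \<beta> \<longleftrightarrow>
     (m > 0 \<longrightarrow> \<alpha> (m - 1) = Pinf) \<and> \<beta> m = Pinf \<and> \<beta> m > \<alpha> m \<and>
     (\<forall>i. m \<le> i \<and> i < n \<longrightarrow> \<alpha> i \<ge> \<beta> (Suc i)) \<and>
     (\<forall>i. m < i \<and> i < n \<longrightarrow> \<beta> i \<ge> \<alpha> i) \<and>
     \<beta> n > \<alpha> n \<and> \<alpha> n = Minf \<and> \<beta> (Suc n) = Minf"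

text \<open>The last disjunct is the degenerate case without finite parts, where the chain collapses to
  \<open>\<alpha>\<^bsub>m-1\<^esub> = \<infinity> = \<beta>\<^bsub>m\<^esub> > \<alpha>\<^bsub>m\<^esub> = -\<infinity> = \<beta>\<^bsub>m+1\<^esub>\<close>. It is what the complement of a tableau of
  empty shapes consists of.\<close>

definition stable_horizontal_strip ::
  "(nat \<Rightarrow> int extended) \<Rightarrow> (nat \<Rightarrow> int extended) \<Rightarrow> bool" where
  "stable_horizontal_strip \<alpha> \<beta> \<longleftrightarrow> stable_shape \<alpha> \<and> stable_shape \<beta> \<and> \<alpha> \<le> \<beta> \<and>
     ((\<exists>m n. first_finite \<alpha> m \<and> last_finite \<beta> n \<and> interlacing m n \<alpha> \<beta>) \<or>
      ((\<forall>i. \<not> finite_part \<alpha> i \<and> \<not> finite_part \<beta> i) \<and> (\<exists>m. interlacing m m \<alpha> \<beta>)))"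

definition stable_tableau :: "nat \<Rightarrow> (nat \<Rightarrow> int extended) list \<Rightarrow> bool" where
  "stable_tableau k T \<longleftrightarrow> length T = Suc k \<and> (\<forall>\<gamma> \<in> set T. stable_shape \<gamma>) \<and>
     (\<forall>i<k. stable_horizontal_strip (T ! i) (T ! Suc i))"

definition stable_tableau_of_shape ::
  "nat \<Rightarrow> (nat \<Rightarrow> int extended) list \<Rightarrow> (nat \<Rightarrow> int extended) \<Rightarrow> (nat \<Rightarrow> int extended) \<Rightarrow> bool" where
  "stable_tableau_of_shape k T \<beta> \<alpha> \<longleftrightarrow> stable_tableau k T \<and> T ! k = \<beta> \<and> T ! 0 = \<alpha>"

text \<open>For an ordinary tableau \<open>T\<close>, the complement is taken of \<open>map stable_of T\<close>.\<close>

definition stable_complement ::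
  "(nat \<Rightarrow> int extended) list \<Rightarrow> (nat \<Rightarrow> int extended) list" where
  "stable_complement T =
     map (\<lambda>i. prepend_inf i (T ! (length T - 1 - i))) [0..<length T]"

text \<open>The number of initial positions at which all shapes of the chain have part \<open>\<infinity>\<close>.\<close>

definition common_inf :: "(nat \<Rightarrow> int extended) list \<Rightarrow> nat" where
  "common_inf T = (LEAST j. \<exists>\<gamma> \<in> set T. \<gamma> j \<noteq> Pinf)"

definition remove_common_inf ::
  "(nat \<Rightarrow> int extended) list \<Rightarrow> (nat \<Rightarrow> int extended) list" where
  "remove_common_inf T = map (\<lambda>\<gamma> i. \<gamma> (i + common_inf T)) T"

definition shift_equiv ::
  "(nat \<Rightarrow> int extended) list \<Rightarrow> (nat \<Rightarrow> int extended) list \<Rightarrow> bool" where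
  "shift_equiv T U \<longleftrightarrow>
     (\<exists>m. T = map (prepend_inf m) U \<or> U = map (prepend_inf m) T)"

end

theory Submission
  imports Defs
begin

text \<open>Every stable shape is uniquely \<open>(\<infinity>\<^sup>m, c)\<close> with \<open>c\<close> an ordinary shape. In these coordinates
  \<open>(\<infinity>\<^sup>m, a) \<subseteq> (\<infinity>\<^bsup>m'\<^esup>, b)\<close> is a stable horizontal strip iff \<open>m' = m + 1\<close> and \<open>a / b\<close> is an
  ordinary horizontal strip. Hence a stable tableau is a chain \<open>(\<infinity>\<^bsup>m+i\<^esup>, u\<^sub>i)\<close> where
  \<open>u\<^sub>k, \<dots>, u\<^sub>0\<close> is an ordinary tableau, and the complement merely reverses the chain
  while making the number of leading \<open>\<infinity>\<close>'s constant.\<close>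

section \<open>Normal form of stable shapes\<close>

lemma prepend_inf_0 [simp]: "prepend_inf 0 \<gamma> = \<gamma>"
  by (simp add: prepend_inf_def)

lemma prepend_inf_prepend_inf: "prepend_inf i (prepend_inf j \<gamma>) = prepend_inf (i + j) \<gamma>"
  by (rule ext) (auto simp: prepend_inf_def)

lemma prepend_inf_stable_of_apply:
  "prepend_inf m (stable_of c) i =
     (if i < m then Pinf else if i < m + length c then Fin (c ! (i - m)) else Minf)"
  by (auto simp: prepend_inf_def stable_of_def)

lemma stable_shape_prepend_inf_stable_of:
  assumes "shape c"
  shows "stable_shape (prepend_inf m (stable_of c))"
  unfolding stable_shape_def
proof
  show "antimono (prepend_inf m (stable_of c))"
  proof (rule antimonoI)
    fix i j :: nat
    assume "i \<le> j"
    moreover have "c ! (j - m) \<le> c ! (i - m)" if "i \<le> j" "m \<le> i" "j < m + length c"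
      using that assms
      by (cases "i = j") (auto simp: shape_def sorted_wrt_iff_nth_less)
    ultimately show "prepend_inf m (stable_of c) j \<le> prepend_inf m (stable_of c) i"
      by (auto simp: prepend_inf_stable_of_apply)
  qed
  show "\<exists>l. \<forall>i\<ge>l. prepend_inf m (stable_of c) i = Minf"
    by (rule exI[of _ "m + length c"]) (auto simp: prepend_inf_stable_of_apply)
qed

text \<open>By antimonotonicity the values \<open>Pinf\<close> fill an initial segment, ending
  before \<open>m\<close>, and the values \<open>Minf\<close> a final one, starting at
  \<open>q\<close>; what lies between is finite and makes up \<open>c\<close>.\<close>

lemma stable_shapeE:
  assumes "stable_shape \<gamma>"
  obtains m c where "shape c" "\<gamma> = prepend_inf m (stable_of c)"
proof -
  obtain l where l: "\<forall>i\<ge>l. \<gamma> i = Minf" and anti: "antimono \<gamma>"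
    using assms by (auto simp: stable_shape_def)
  define m where "m = (LEAST i. \<gamma> i \<noteq> Pinf)"
  define q where "q = (LEAST i. \<gamma> i = Minf)"
  have m: "\<gamma> m \<noteq> Pinf"
    unfolding m_def using l LeastI[of "\<lambda>i. \<gamma> i \<noteq> Pinf" l] by simp
  have q: "\<gamma> q = Minf"
    unfolding q_def using l LeastI[of "\<lambda>i. \<gamma> i = Minf" l] by simp
  have below_m: "\<gamma> i = Pinf" if "i < m" for i
    using that not_less_Least unfolding m_def by blast
  have below_q: "\<gamma> i \<noteq> Minf" if "i < q" for i
    using that not_less_Least unfolding q_def by blast
  have above_m: "\<gamma> i \<noteq> Pinf" if "m \<le> i" for i
    using antimonoD[OF anti that] m by (cases "\<gamma> i"; cases "\<gamma> m") auto
  have above_q: "\<gamma> i = Minf" if "q \<le> i" for i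
    using antimonoD[OF anti that] q by (cases "\<gamma> i") auto
  have "m \<le> q"
    using below_m[of q] q by (metis extended.distinct(5) not_le)
  \<comment> \<open>The description is well defined, since no part at a position from
    \<open>m\<close> to \<open>q - 1\<close> is infinite; \<open>c\<close> is empty when
    \<open>m = q\<close>.\<close>
  define c where "c = map (\<lambda>i. THE z. \<gamma> (m + i) = Fin z) [0..<q - m]"
  have fin: "\<gamma> (m + i) = Fin (c ! i)" if "i < q - m" for i
    using that above_m[of "m + i"] below_q[of "m + i"]
    by (cases "\<gamma> (m + i)") (auto simp: c_def less_diff_conv add.commute)
  have len: "length c = q - m"
    by (simp add: c_def)
  have "shape c"
    unfolding shape_def sorted_wrt_iff_nth_less
  proof (intro allI impI)
    fix i j assume "i < j" "j < length c"
    then show "c ! i \<ge> c ! j"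
      using antimonoD[OF anti, of "m + i" "m + j"] fin[of i] fin[of j] len by simp
  qed
  moreover have "\<gamma> = prepend_inf m (stable_of c)"
  proof
    fix i
    show "\<gamma> i = prepend_inf m (stable_of c) i"
      using below_m[of i] above_q[of i] fin[of "i - m"] len \<open>m \<le> q\<close>
      by (auto simp: prepend_inf_stable_of_apply)
  qed
  ultimately show thesis
    using that by blast
qed

section \<open>Stable horizontal strips in normal form\<close>

lemma finite_part_prepend_inf_stable_of:
  "finite_part (prepend_inf m (stable_of c)) i \<longleftrightarrow> m \<le> i \<and> i < m + length c"
  by (auto simp: finite_part_def prepend_inf_stable_of_apply)

lemma first_finite_prepend_inf_stable_of:
  "first_finite (prepend_inf m (stable_of c)) i \<longleftrightarrow> c \<noteq> [] \<and> i = m"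
  by (auto simp: first_finite_def finite_part_prepend_inf_stable_of)
     (metis le_neq_implies_less less_le_trans order_refl)

lemma last_finite_prepend_inf_stable_of:
  "last_finite (prepend_inf m (stable_of c)) i \<longleftrightarrow> c \<noteq> [] \<and> Suc i = m + length c"
proof
  assume *: "last_finite (prepend_inf m (stable_of c)) i"
  then have "m \<le> i" "i < m + length c" "\<not> (m \<le> Suc i \<and> Suc i < m + length c)"
    unfolding last_finite_def finite_part_prepend_inf_stable_of by blast+
  then show "c \<noteq> [] \<and> Suc i = m + length c"
    by auto
next
  assume "c \<noteq> [] \<and> Suc i = m + length c"
  moreover from this have "m \<le> i"
    by (cases c) auto
  ultimately show "last_finite (prepend_inf m (stable_of c)) i"
    by (auto simp: last_finite_def finite_part_prepend_inf_stable_of)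
qed

text \<open>The upper end of the chain fixes the number of leading \<open>Pinf\<close>s, the lower
  end makes the lengths equal, and the inner inequalities are those of an ordinary strip with the
  roles of the two shapes exchanged.\<close>

lemma horizontal_strip_of_stable_horizontal_strip:
  assumes "stable_horizontal_strip (prepend_inf m (stable_of a)) (prepend_inf m' (stable_of b))"
  shows "m' = Suc m \<and> horizontal_strip b a"
proof -
  let ?\<alpha> = "prepend_inf m (stable_of a)" and ?\<beta> = "prepend_inf m' (stable_of b)"
  note ap = prepend_inf_stable_of_apply
  consider (finite) n where "a \<noteq> []" "Suc n = m' + length b" "interlacing m n ?\<alpha> ?\<beta>"
    | (infinite) j where "\<forall>i. \<not> finite_part ?\<alpha> i \<and> \<not> finite_part ?\<beta> i" "interlacing j j ?\<alpha> ?\<beta>"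
    using assms
    unfolding stable_horizontal_strip_def first_finite_prepend_inf_stable_of
      last_finite_prepend_inf_stable_of by blast
  then show ?thesis
  proof cases
    case finite
    have top: "?\<beta> m = Pinf" and bot: "?\<alpha> n = Minf" "?\<beta> n > ?\<alpha> n"
      and upper: "\<And>i. m \<le> i \<Longrightarrow> i < n \<Longrightarrow> ?\<alpha> i \<ge> ?\<beta> (Suc i)"
      and lower: "\<And>i. m < i \<Longrightarrow> i < n \<Longrightarrow> ?\<beta> i \<ge> ?\<alpha> i"
      using finite(3) unfolding interlacing_def by blast+
    have "length a > 0"
      using finite(1) by simp
    have "m < m'"
      using top by (simp add: ap split: if_splits)
    have "m + length a \<le> n"
      using bot(1) by (simp add: ap split: if_splits)
    then have "m < n"
      using \<open>length a > 0\<close> by linarith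
    \<comment> \<open>Part \<open>m\<close> of \<open>?\<alpha>\<close> is finite because
      \<open>a\<close> is nonempty, so part \<open>Suc m\<close> of \<open>?\<beta>\<close> cannot
      be \<open>Pinf\<close>.\<close>
    have "m' \<le> Suc m"
      using upper[OF order_refl \<open>m < n\<close>] \<open>length a > 0\<close> by (simp add: ap split: if_splits)
    then have m': "m' = Suc m"
      using \<open>m < m'\<close> by simp
    then have n: "n = m + length b"
      using finite(2) by simp
    \<comment> \<open>Part \<open>n\<close> of \<open>?\<beta>\<close> is its last finite part, so
      part \<open>n - 1\<close> of \<open>?\<alpha>\<close>, which bounds it from above, is not
      \<open>Minf\<close>.\<close>
    have "n - 1 < m + length a"
      using upper[of "n - 1"] \<open>m < n\<close> n m'
      by (cases "n - 1 < m + length a") (auto simp: ap Suc_le_eq)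
    then have len: "length a = length b"
      using n \<open>m + length a \<le> n\<close> \<open>m < n\<close> by linarith
    \<comment> \<open>The finite parts of \<open>?\<beta>\<close> start one position later than
      those of \<open>?\<alpha>\<close>: \<open>b ! i\<close> sits at \<open>Suc (m + i)\<close>,
      the position of \<open>a ! Suc i\<close>. This offset exchanges the two kinds of
      inequalities.\<close>
    have "b ! i \<le> a ! i" if "i < length a" for i
      using upper[of "m + i"] that n len m' by (simp add: ap)
    moreover have "a ! Suc i \<le> b ! i" if "Suc i < length a" for i
      using lower[of "Suc (m + i)"] that n len m' by (simp add: ap Suc_diff_le)
    ultimately show ?thesis
      using m' len by (simp add: horizontal_strip_def)
  next
    case infinite
    have "a = []" "b = []"
      using infinite(1) unfolding finite_part_prepend_inf_stable_of
      by (metis length_greater_0_conv less_add_same_cancel1 order_refl)+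
    \<comment> \<open>With both lists empty, the collapsed chain at \<open>j\<close> forces
      \<open>m = j\<close> and \<open>m' = Suc j\<close>.\<close>
    then show ?thesis
      using infinite(2)
      by (auto simp: interlacing_def ap horizontal_strip_def split: if_splits)
  qed
qed

lemma stable_horizontal_strip_of_horizontal_strip:
  assumes "shape a" "shape b" "horizontal_strip b a"
  shows "stable_horizontal_strip (prepend_inf m (stable_of a)) (prepend_inf (Suc m) (stable_of b))"
proof -
  let ?\<alpha> = "prepend_inf m (stable_of a)" and ?\<beta> = "prepend_inf (Suc m) (stable_of b)"
  note ap = prepend_inf_stable_of_apply
  have len: "length b = length a"
    and upper: "\<And>i. i < length a \<Longrightarrow> b ! i \<le> a ! i"
    and lower: "\<And>i. Suc i < length a \<Longrightarrow> a ! Suc i \<le> b ! i"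
    using assms(3) by (auto simp: horizontal_strip_def)
  have lower': "a ! (i - m) \<le> b ! (i - Suc m)" if "m < i" "i < m + length a" for i
    using that lower[of "i - Suc m"] by (simp add: Suc_diff_Suc)
  have le: "?\<alpha> \<le> ?\<beta>"
    by (rule le_funI) (auto simp: ap len intro!: lower')
  \<comment> \<open>One index serves both cases below: \<open>m + length a\<close> is the last
    finite position of \<open>?\<beta>\<close> if \<open>a\<close> is nonempty, and equals
    \<open>m\<close> if \<open>a\<close> is empty, as the degenerate disjunct demands.\<close>
  have inter: "interlacing m (m + length a) ?\<alpha> ?\<beta>"
    unfolding interlacing_def
    by (auto simp: ap len intro!: upper lower')
  show ?thesis
  proof (cases "a = []")
    case True
    then have "b = []"
      using len by simp
    with True inter le stable_shape_prepend_inf_stable_of[OF assms(1), of m]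
      stable_shape_prepend_inf_stable_of[OF assms(2), of "Suc m"]
    show ?thesis
      by (auto simp: stable_horizontal_strip_def finite_part_prepend_inf_stable_of)
  next
    case False
    then have "first_finite ?\<alpha> m" "last_finite ?\<beta> (m + length a)"
      using len by (auto simp: first_finite_prepend_inf_stable_of last_finite_prepend_inf_stable_of)
    with inter le stable_shape_prepend_inf_stable_of[OF assms(1), of m]
      stable_shape_prepend_inf_stable_of[OF assms(2), of "Suc m"]
    show ?thesis
      unfolding stable_horizontal_strip_def by blast
  qed
qed

text \<open>Each strip adds exactly one leading \<open>Pinf\<close>, so the offsets are determined
  by the offset \<open>m\<close> of the first shape. The ordinary strips run from
  \<open>u (Suc i)\<close> up to \<open>u i\<close>, against the direction of the chain.\<close>

lemma stable_tableauE:
  assumes "stable_tableau k T"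
  obtains m u where "\<And>i. i \<le> k \<Longrightarrow> shape (u i)"
    "\<And>i. i \<le> k \<Longrightarrow> T ! i = prepend_inf (m + i) (stable_of (u i))"
    "\<And>i. i < k \<Longrightarrow> horizontal_strip (u (Suc i)) (u i)"
proof -
  have "\<exists>m c. shape c \<and> T ! i = prepend_inf m (stable_of c)" if "i \<le> k" for i
    using that assms by (metis stable_shapeE stable_tableau_def le_imp_less_Suc nth_mem)
  then obtain f u where u: "\<And>i. i \<le> k \<Longrightarrow> shape (u i)"
    and T: "\<And>i. i \<le> k \<Longrightarrow> T ! i = prepend_inf (f i) (stable_of (u i))"
    by metis
  have step: "f (Suc i) = Suc (f i) \<and> horizontal_strip (u (Suc i)) (u i)" if "i < k" for i
    using that assms T[of i] T[of "Suc i"] horizontal_strip_of_stable_horizontal_strip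
    unfolding stable_tableau_def by (metis Suc_leI less_imp_le)
  have "f i = f 0 + i" if "i \<le> k" for i
    using that by (induction i) (auto simp: step)
  then show thesis
    using that[of u "f 0"] u T step by metis
qed

section \<open>Complements of ordinary and stable tableaux\<close>

lemma length_stable_complement [simp]: "length (stable_complement T) = length T"
  by (simp add: stable_complement_def)

lemma nth_stable_complement:
  "i < length T \<Longrightarrow> stable_complement T ! i = prepend_inf i (T ! (length T - 1 - i))"
  by (simp add: stable_complement_def)

text \<open>With \<open>n = length T\<close>, shape \<open>i\<close> receives
  \<open>n - 1 - i\<close> parts \<open>Pinf\<close> from the first complement and \<open>i\<close>
  from the second, a total independent of \<open>i\<close>.\<close>

lemma stable_complement_stable_complement:
  "stable_complement (stable_complement T) = map (prepend_inf (length T - 1)) T"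
  by (rule nth_equalityI) (auto simp: nth_stable_complement prepend_inf_prepend_inf)

lemma common_inf_prepend_inf_stable_of:
  assumes "C \<noteq> []"
  shows "common_inf (map (\<lambda>c. prepend_inf m (stable_of c)) C) = m"
  unfolding common_inf_def
proof (rule Least_equality)
  show "\<exists>\<gamma>\<in>set (map (\<lambda>c. prepend_inf m (stable_of c)) C). \<gamma> m \<noteq> Pinf"
    using assms by (cases C) (auto simp: prepend_inf_stable_of_apply)
  show "m \<le> j" if "\<exists>\<gamma>\<in>set (map (\<lambda>c. prepend_inf m (stable_of c)) C). \<gamma> j \<noteq> Pinf" for j
    using that by (auto simp: prepend_inf_stable_of_apply split: if_splits)
qed

lemma remove_common_inf_prepend_inf_stable_of:
  assumes "C \<noteq> []"
  shows "remove_common_inf (map (\<lambda>c. prepend_inf m (stable_of c)) C) = map stable_of C"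
  by (simp add: remove_common_inf_def common_inf_prepend_inf_stable_of[OF assms])
     (simp add: prepend_inf_def)

lemma stable_complement_of_tableau:
  assumes "tableau k T"
  shows "stable_tableau k (stable_complement (map stable_of T))"
proof -
  have len: "length T = Suc k"
    and strip: "\<And>i. i < k \<Longrightarrow> horizontal_strip (T ! i) (T ! Suc i)"
    using assms by (auto simp: tableau_def)
  have shape: "shape (T ! i)" if "i \<le> k" for i
    using that assms by (simp add: tableau_def)
  let ?C = "stable_complement (map stable_of T)"
  have nth: "?C ! i = prepend_inf i (stable_of (T ! (k - i)))" if "i \<le> k" for i
    using that len by (simp add: nth_stable_complement)
  have "stable_shape \<gamma>" if "\<gamma> \<in> set ?C" for \<gamma>
    using that len shape nth stable_shape_prepend_inf_stable_of
    by (auto simp: in_set_conv_nth less_Suc_eq_le)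
  \<comment> \<open>The strip from \<open>T ! (k - Suc i)\<close> to \<open>T ! (k - i)\<close>,
    read backwards.\<close>
  moreover have "stable_horizontal_strip (?C ! i) (?C ! Suc i)" if "i < k" for i
    using that strip[of "k - Suc i"]
    by (auto simp: nth Suc_diff_Suc intro!: stable_horizontal_strip_of_horizontal_strip shape)
  ultimately show ?thesis
    using len by (simp add: stable_tableau_def)
qed

lemma tableau_of_stable_complement:
  assumes "stable_tableau k T"
  shows "\<exists>U. tableau k U \<and> remove_common_inf (stable_complement T) = map stable_of U \<and>
    shift_equiv (stable_complement (map stable_of U)) T"
proof -
  obtain m u where u: "\<And>i. i \<le> k \<Longrightarrow> shape (u i)"
    and T: "\<And>i. i \<le> k \<Longrightarrow> T ! i = prepend_inf (m + i) (stable_of (u i))"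
    and strip: "\<And>i. i < k \<Longrightarrow> horizontal_strip (u (Suc i)) (u i)"
    using stable_tableauE[OF assms] by metis
  have len: "length T = Suc k"
    using assms by (simp add: stable_tableau_def)
  \<comment> \<open>Reversal turns the descending chain of the \<open>u i\<close> into an ordinary
    tableau.\<close>
  define U where "U = map (\<lambda>i. u (k - i)) [0..<Suc k]"
  have lenU: "length U = Suc k" and nthU: "\<And>i. i \<le> k \<Longrightarrow> U ! i = u (k - i)"
    by (simp_all add: U_def del: upt_Suc)
  have "horizontal_strip (U ! i) (U ! Suc i)" if "i < k" for i
    using that strip[of "k - Suc i"] by (simp add: nthU Suc_diff_Suc)
  then have "tableau k U"
    using lenU u nthU by (auto simp: tableau_def in_set_conv_nth less_Suc_eq_le)
  \<comment> \<open>Shape \<open>i\<close> is built from offset \<open>m + (k - i)\<close> and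
    \<open>i\<close> further \<open>Pinf\<close>s, so all shapes share the offset
    \<open>m + k\<close>, which is then removed.\<close>
  moreover have "stable_complement T = map (\<lambda>c. prepend_inf (m + k) (stable_of c)) U"
    using len lenU
    by (intro nth_equalityI)
      (auto simp: nth_stable_complement nthU T less_Suc_eq_le prepend_inf_prepend_inf)
  moreover have "U \<noteq> []"
    using lenU by auto
  \<comment> \<open>Complementing \<open>U\<close> gives back the offsets \<open>i\<close> and the
    order of \<open>T\<close>; only the initial offset \<open>m\<close> is lost, which is a vertical
    shift.\<close>
  moreover have "T = map (prepend_inf m) (stable_complement (map stable_of U))"
    using len lenU
    by (intro nth_equalityI)
      (auto simp: nth_stable_complement nthU T less_Suc_eq_le prepend_inf_prepend_inf)
  ultimately show ?thesis
    using remove_common_inf_prepend_inf_stable_of unfolding shift_equiv_def by metis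
qed

theorem theorem5p4:
  fixes k :: nat
  shows "(\<forall>T \<alpha> \<beta>. tableau_of_shape k T \<beta> \<alpha> \<longrightarrow>
            stable_tableau_of_shape k (stable_complement (map stable_of T))
              (prepend_inf k (stable_of \<alpha>)) (stable_of \<beta>) \<and>
            shift_equiv (stable_complement (stable_complement (map stable_of T)))
              (map stable_of T)) \<and>
         (\<forall>T. stable_tableau k T \<longrightarrow>
            (\<exists>U. tableau k U \<and>
                 remove_common_inf (stable_complement T) = map stable_of U \<and>
                 shift_equiv (stable_complement (map stable_of U)) T) \<and>
            shift_equiv (stable_complement (stable_complement T)) T)"
proof -
  \<comment> \<open>The uniform shift by \<open>length T - 1\<close> holds for every chain, so this
    covers both the ordinary and the stable case.\<close>
  have double: "shift_equiv (stable_complement (stable_complement T)) T" for T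
    using stable_complement_stable_complement unfolding shift_equiv_def by blast
  have "stable_tableau_of_shape k (stable_complement (map stable_of T))
      (prepend_inf k (stable_of \<alpha>)) (stable_of \<beta>)" if "tableau_of_shape k T \<beta> \<alpha>" for T \<alpha> \<beta>
  proof -
    have "tableau k T" "length T = Suc k" "T ! k = \<beta>" "T ! 0 = \<alpha>"
      using that by (auto simp: tableau_of_shape_def tableau_def)
    then show ?thesis
      using stable_complement_of_tableau[of k T]
      by (simp add: stable_tableau_of_shape_def nth_stable_complement)
  qed
  then show ?thesis
    using double tableau_of_stable_complement by blast
qed

end
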